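(* Let $K\subseteq\mathbb{R}^n$ be a proper convex cone and let $f\in\mathbb{R}[x_1,\dots,x_n]$ be a nonzero $K$-CLC polynomial of degree $d$. Then for any $x,v\in\operatorname{int}K$, the coefficients (of $t^0,t^1,\dots,t^d$) of the univariate polynomial $f(x+tv)$ in $t$ are positive.
   Context: A proper convex cone $K\subseteq\mathbb{R}^n$ is a nonempty convex set with $cK\subseteq K$ for all $c\ge0$ that is closed, pointed ($K\cap(-K)=\{0\}$) and has nonempty interior $\operatorname{int}K$. For $a\in\mathbb{R}^n$, $D_af=\sum_i a_i\,\partial f/\partial x_i$. A polynomial $f$ is log-concave at a point $a$ if $f(a)>0$ and the Hessian of $\log f$ at $a$ is negative semidefinite; by convention the zero polynomial is log-concave at all points. A polynomial $f$ of degree $d$ is $K$-completely log-concave ($K$-CLC) if for all $0\le m\le d$ and all $a_1,\dots,a_m\in K$, the polynomial $D_{a_1}\cdots D_{a_m}f$ is log-concave at every point of $\operatorname{int}K$. *)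

theory Defs
  imports
    "HOL-Analysis.Analysis"
    "HOL-Computational_Algebra.Polynomial"
    "HOL-Library.Poly_Mapping"
begin

text \<open>
  Formal polynomials in the variables \<open>x\<^sub>i\<close> (\<open>i\<close> ranging over the finite type \<open>'n\<close>) with real
  coefficients: a monomial is its finitely supported exponent vector, a polynomial is a finitely
  supported map from monomials to coefficients. Ring operations come from \<open>Poly_Mapping\<close>.
\<close>

type_synonym 'n mpoly = "('n \<Rightarrow>\<^sub>0 nat) \<Rightarrow>\<^sub>0 real"

definition meval :: "'n::finite mpoly \<Rightarrow> real ^ 'n \<Rightarrow> real" where
  "meval p x = (\<Sum>m\<in>Poly_Mapping.keys p.
     Poly_Mapping.lookup p m * (\<Prod>i\<in>UNIV. (x $ i) ^ Poly_Mapping.lookup m i))"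

text \<open>The zero polynomial gets total degree \<open>0\<close>.\<close>

definition total_degree :: "'n::finite mpoly \<Rightarrow> nat" where
  "total_degree p =
     Max (insert 0 ((\<lambda>m. \<Sum>i\<in>UNIV. Poly_Mapping.lookup m i) ` Poly_Mapping.keys p))"

text \<open>
  Formal partial derivative. The exponent subtraction truncates at \<open>0\<close>, but then the
  coefficient vanishes.
\<close>

definition mpderiv :: "'n::finite \<Rightarrow> 'n mpoly \<Rightarrow> 'n mpoly" where
  "mpderiv i p = (\<Sum>m\<in>Poly_Mapping.keys p.
     Poly_Mapping.single (m - Poly_Mapping.single i 1)
       (real (Poly_Mapping.lookup m i) * Poly_Mapping.lookup p m))"

text \<open>\<open>Poly_Mapping.single 0 c\<close> is the constant polynomial \<open>c\<close>.\<close>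

definition dir_deriv :: "real ^ 'n \<Rightarrow> 'n::finite mpoly \<Rightarrow> 'n mpoly" where
  "dir_deriv a p = (\<Sum>i\<in>UNIV. Poly_Mapping.single 0 (a $ i) * mpderiv i p)"

text \<open>\<open>f(x + t v)\<close> as a formal univariate polynomial in \<open>t\<close>: substitute \<open>x\<^sub>i + v\<^sub>i t\<close> for the
  \<open>i\<close>-th variable.\<close>

definition line_poly :: "'n::finite mpoly \<Rightarrow> real ^ 'n \<Rightarrow> real ^ 'n \<Rightarrow> real poly" where
  "line_poly p x v = (\<Sum>m\<in>Poly_Mapping.keys p.
     smult (Poly_Mapping.lookup p m) (\<Prod>i\<in>UNIV. [:x $ i, v $ i:] ^ Poly_Mapping.lookup m i))"

definition fun_partial :: "'n::finite \<Rightarrow> (real ^ 'n \<Rightarrow> real) \<Rightarrow> real ^ 'n \<Rightarrow> real" where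
  "fun_partial i g x = deriv (\<lambda>t. g (x + t *\<^sub>R axis i 1)) 0"

definition hessian :: "(real ^ 'n \<Rightarrow> real) \<Rightarrow> real ^ 'n \<Rightarrow> real ^ 'n ^ 'n::finite" where
  "hessian g x = (\<chi> i j. fun_partial i (fun_partial j g) x)"

text \<open>Symmetry is not demanded; it is automatic for the Hessians of smooth functions below.\<close>

definition neg_semidefinite :: "real ^ 'n ^ 'n::finite \<Rightarrow> bool" where
  "neg_semidefinite A \<longleftrightarrow> (\<forall>u. u \<bullet> (A *v u) \<le> 0)"

text \<open>
  Where \<open>f > 0\<close>, \<open>ln \<circ> f\<close> is smooth nearby, so the values of \<open>ln\<close> and \<open>deriv\<close> outside their
  proper domains play no role.
\<close>

definition log_concave_at :: "'n::finite mpoly \<Rightarrow> real ^ 'n \<Rightarrow> bool" where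
  "log_concave_at f a \<longleftrightarrow>
     f = 0 \<or> (meval f a > 0 \<and> neg_semidefinite (hessian (\<lambda>x. ln (meval f x)) a))"

definition proper_convex_cone :: "(real ^ 'n::finite) set \<Rightarrow> bool" where
  "proper_convex_cone K \<longleftrightarrow>
     convex_cone K \<and> closed K \<and> K \<inter> uminus ` K = {0} \<and> interior K \<noteq> {}"

text \<open>The list \<open>as\<close> is \<open>[a\<^sub>1, \<dots>, a\<^sub>m]\<close> and the fold is \<open>D a\<^sub>1 (\<dots> (D a\<^sub>m f))\<close>.\<close>

definition completely_log_concave :: "(real ^ 'n::finite) set \<Rightarrow> 'n mpoly \<Rightarrow> bool" where
  "completely_log_concave K f \<longleftrightarrow>
     (\<forall>as. length as \<le> total_degree f \<longrightarrow> set as \<subseteq> K \<longrightarrow>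
        (\<forall>x\<in>interior K. log_concave_at (foldr dir_deriv as f) x))"

lemma poly_line_poly: "poly (line_poly p x v) t = meval p (x + t *\<^sub>R v)"
  by (simp add: line_poly_def meval_def poly_sum poly_prod algebra_simps)

lemma meval_superset:
  assumes "finite S" "Poly_Mapping.keys p \<subseteq> S"
  shows "meval p x = (\<Sum>m\<in>S. Poly_Mapping.lookup p m * (\<Prod>i\<in>UNIV. (x $ i) ^ Poly_Mapping.lookup m i))"
  unfolding meval_def using assms
  by (intro sum.mono_neutral_left) (auto simp: in_keys_iff)

lemma meval_zero [simp]: "meval 0 x = 0"
  by (simp add: meval_def)

lemma meval_add: "meval (p + q) x = meval p x + meval q x"
proof -
  let ?S = "Poly_Mapping.keys p \<union> Poly_Mapping.keys q"
  have "Poly_Mapping.keys (p + q) \<subseteq> ?S" by (rule keys_add)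
  then show ?thesis
    by (simp add: meval_superset[where S = ?S] lookup_add distrib_right sum.distrib)
qed

lemma meval_sum: "meval (\<Sum>s\<in>A. g s) x = (\<Sum>s\<in>A. meval (g s) x)"
  by (induction A rule: infinite_finite_induct) (auto simp: meval_add)

lemma meval_single:
  "meval (Poly_Mapping.single m c) x = c * (\<Prod>i\<in>UNIV. (x $ i) ^ Poly_Mapping.lookup m i)"
  by (simp add: meval_superset[where S = "{m}"])

lemma fun_partial_meval: "fun_partial i (meval p) x = meval (mpderiv i p) x"
proof -
  have split: "(\<Prod>j\<in>UNIV. F j) = F i * (\<Prod>j\<in>UNIV - {i}. F j)" for F :: "'a \<Rightarrow> real"
    by (simp add: prod.remove)
  define C where "C m = (\<Prod>j\<in>UNIV - {i}. (x $ j) ^ Poly_Mapping.lookup m j)" for m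
  have line: "meval p (x + t *\<^sub>R axis i 1) =
      (\<Sum>m\<in>Poly_Mapping.keys p.
         Poly_Mapping.lookup p m * ((x $ i + t) ^ Poly_Mapping.lookup m i * C m))" for t
  proof -
    have "(\<Prod>j\<in>UNIV - {i}. ((x + t *\<^sub>R axis i 1) $ j) ^ Poly_Mapping.lookup m j) = C m" for m
      unfolding C_def by (intro prod.cong) (auto simp: axis_def)
    then show ?thesis
      unfolding meval_def by (subst split) (simp add: axis_def)
  qed
  have "meval (mpderiv i p) x = (\<Sum>m\<in>Poly_Mapping.keys p.
      Poly_Mapping.lookup p m *
        (real (Poly_Mapping.lookup m i) * (x $ i) ^ (Poly_Mapping.lookup m i - 1) * C m))"
  proof -
    have "(\<Prod>j\<in>UNIV - {i}. (x $ j) ^ Poly_Mapping.lookup (m - Poly_Mapping.single i 1) j) = C m"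
      for m
      unfolding C_def by (intro prod.cong) (auto simp: lookup_minus lookup_single)
    then show ?thesis
      unfolding mpderiv_def meval_sum meval_single
      by (subst split) (simp add: lookup_minus lookup_single algebra_simps)
  qed
  moreover have "((\<lambda>t. meval p (x + t *\<^sub>R axis i 1)) has_real_derivative
      (\<Sum>m\<in>Poly_Mapping.keys p. Poly_Mapping.lookup p m *
        (real (Poly_Mapping.lookup m i) * (x $ i) ^ (Poly_Mapping.lookup m i - 1) * C m))) (at 0)"
    unfolding line by (auto intro!: derivative_eq_intros sum.cong)
  ultimately show ?thesis
    unfolding fun_partial_def by (simp add: DERIV_imp_deriv)
qed

end

theory Submission
  imports Defs
begin

text \<open>
  Write \<open>D\<close> for the directional derivative. The coefficient of \<open>t\<^sup>k\<close> in \<open>f(x + t v)\<close> is the value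
  at \<open>x\<close> of \<open>D\<^sub>v\<^sup>k f / k!\<close>. Complete log-concavity makes every iterated derivative with \<open>k \<le> d\<close>
  either the zero polynomial or positive on \<open>int K\<close>, so it is enough that \<open>D\<^sub>v\<^sup>k f \<noteq> 0\<close>, and this
  holds as soon as \<open>f(x + t v)\<close> really has degree \<open>d\<close> in \<open>t\<close>, that is, as soon as the
  homogeneous part of degree \<open>d\<close> of \<open>f\<close> does not vanish at \<open>v\<close>.

  The degree cannot drop, because \<open>f\<close> is monotone. Let \<open>d > 0\<close>. For each \<open>u \<in> K\<close> the polynomial
  \<open>D\<^sub>u f\<close> is zero or positive on \<open>int K\<close>, so adding a vector of \<open>K\<close> to a point of \<open>int K\<close> never
  decreases \<open>f\<close>. If both \<open>w\<close> and \<open>v - w\<close> lie in \<open>int K\<close>, then \<open>0 < f(x + t w) \<le> f(x + t v)\<close> for all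
  \<open>t \<ge> 0\<close>, and comparing growth, the degree of \<open>f(x + t w)\<close> is at most that of \<open>f(x + t v)\<close>
  (\<open>degree_mono_of_poly_le\<close>). Such vectors \<open>w\<close> form an open set, which contains \<open>v / 2\<close>. If the
  degree of \<open>f(x + t v)\<close> were less than \<open>d\<close>, the top homogeneous part of \<open>f\<close> would vanish on that
  open set and hence be zero (\<open>mpoly_eq_0_if_vanishes_on_open\<close>), contradicting that \<open>f\<close> has
  degree \<open>d\<close>.
\<close>

section \<open>Monomials and formal derivatives\<close>

definition monom_degree :: "('n::finite \<Rightarrow>\<^sub>0 nat) \<Rightarrow> nat" where
  "monom_degree m = (\<Sum>i\<in>UNIV. Poly_Mapping.lookup m i)"

lemma monom_degree_le_total_degree:
  assumes "m \<in> Poly_Mapping.keys p"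
  shows "monom_degree m \<le> total_degree p"
  unfolding total_degree_def monom_degree_def using assms by (intro Max_ge) auto

lemma monom_of_total_degree:
  assumes "p \<noteq> 0"
  obtains m where "m \<in> Poly_Mapping.keys p" "monom_degree m = total_degree p"
proof -
  let ?S = "insert 0 (monom_degree ` Poly_Mapping.keys p)"
  have eq: "total_degree p = Max ?S"
    by (simp add: total_degree_def monom_degree_def [abs_def])
  have "Max ?S \<in> ?S" by (intro Max_in) auto
  moreover from assms obtain m where m: "m \<in> Poly_Mapping.keys p"
    using poly_mapping_eqI [of p 0] by (auto simp: in_keys_iff)
  ultimately consider "total_degree p = 0" | "total_degree p \<in> monom_degree ` Poly_Mapping.keys p"
    using eq by auto
  then show thesis
    by cases (use that [of m] m monom_degree_le_total_degree [OF m] that in auto)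
qed

lemma monom_degree_plus_single: "monom_degree (m + Poly_Mapping.single i 1) = Suc (monom_degree m)"
proof -
  have "(\<Sum>j\<in>UNIV. Poly_Mapping.lookup (Poly_Mapping.single i (1::nat)) j) = 1"
    by (simp add: lookup_single when_def)
  then show ?thesis by (simp add: monom_degree_def lookup_add sum.distrib)
qed

lemma lookup_mpderiv:
  "Poly_Mapping.lookup (mpderiv i p) m
     = real (Suc (Poly_Mapping.lookup m i)) * Poly_Mapping.lookup p (m + Poly_Mapping.single i 1)"
proof -
  let ?e = "Poly_Mapping.single i (1::nat)"
  \<comment> \<open>The truncated subtraction merges monomials only where the factor \<open>m'\<^sub>i\<close> is zero.\<close>
  have unique: "real (Poly_Mapping.lookup m' i) * Poly_Mapping.lookup p m' * of_bool (m' - ?e = m)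
      = (if m' = m + ?e then real (Suc (Poly_Mapping.lookup m i)) * Poly_Mapping.lookup p (m + ?e) else 0)" for m'
  proof (cases "Poly_Mapping.lookup m' i = 0")
    case True
    then show ?thesis by (auto simp: lookup_add)
  next
    case False
    then have "m' - ?e + ?e = m'"
      by (intro poly_mapping_eqI) (auto simp: lookup_add lookup_minus lookup_single when_def)
    then have "m' - ?e = m \<longleftrightarrow> m' = m + ?e" by auto
    then show ?thesis by (auto simp: lookup_add)
  qed
  have "Poly_Mapping.lookup (mpderiv i p) m
      = (\<Sum>m'\<in>Poly_Mapping.keys p. real (Poly_Mapping.lookup m' i) * Poly_Mapping.lookup p m' * of_bool (m' - ?e = m))"
    unfolding mpderiv_def lookup_sum lookup_single when_def
    by (intro sum.cong) auto
  also have "\<dots> = real (Suc (Poly_Mapping.lookup m i)) * Poly_Mapping.lookup p (m + ?e)"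
    unfolding unique by (simp add: in_keys_iff)
  finally show ?thesis .
qed

lemma meval_dir_deriv: "meval (dir_deriv a p) x = (\<Sum>i\<in>UNIV. a $ i * meval (mpderiv i p) x)"
proof -
  have "meval (Poly_Mapping.single 0 c * q) x = c * meval q x" for c and q :: "'a mpoly"
  proof -
    have lk: "Poly_Mapping.lookup (Poly_Mapping.single 0 c * q) m = c * Poly_Mapping.lookup q m" for m
      by (simp add: mult_map_scale_conv_mult [symmetric] Poly_Mapping.map.rep_eq when_def)
    then have "Poly_Mapping.keys (Poly_Mapping.single 0 c * q) \<subseteq> Poly_Mapping.keys q" by (auto simp: in_keys_iff)
    then show ?thesis
      by (simp add: meval_superset [where S = "Poly_Mapping.keys q"] lk sum_distrib_left mult.assoc)
  qed
  then show ?thesis by (simp add: dir_deriv_def meval_sum)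
qed

text \<open>
  All partial derivatives vanish on the same open set, so by induction on the degree they are zero
  as polynomials. This leaves a constant polynomial, and its value is zero.
\<close>

lemma mpoly_eq_0_if_vanishes_on_open:
  fixes p :: "'n::finite mpoly"
  assumes "open S" "S \<noteq> {}" and "\<And>y. y \<in> S \<Longrightarrow> meval p y = 0"
  shows "p = 0"
proof -
  have "\<forall>p :: 'n mpoly. (\<forall>m\<in>Poly_Mapping.keys p. monom_degree m \<le> n) \<longrightarrow> (\<forall>y\<in>S. meval p y = 0) \<longrightarrow> p = 0"
    for n
  proof (induction n)
    case 0
    show ?case
    proof (intro allI impI)
      fix p :: "'n mpoly"
      assume deg: "\<forall>m\<in>Poly_Mapping.keys p. monom_degree m \<le> 0" and van: "\<forall>y\<in>S. meval p y = 0"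
      have supp: "Poly_Mapping.keys p \<subseteq> {0}"
        using deg by (auto simp: monom_degree_def intro: poly_mapping_eqI)
      obtain y where "y \<in> S" using assms by auto
      with van have "Poly_Mapping.lookup p 0 = 0"
        using meval_superset [OF _ supp, of y] by simp
      with supp show "p = 0"
        by (intro poly_mapping_eqI) (metis in_keys_iff lookup_zero singletonD subsetD)
    qed
  next
    case (Suc n)
    show ?case
    proof (intro allI impI)
      fix p :: "'n mpoly"
      assume deg: "\<forall>m\<in>Poly_Mapping.keys p. monom_degree m \<le> Suc n" and van: "\<forall>y\<in>S. meval p y = 0"
      have D0: "mpderiv i p = 0" for i
      proof -
        have "\<forall>m\<in>Poly_Mapping.keys (mpderiv i p). monom_degree m \<le> n"
        proof
          fix m assume "m \<in> Poly_Mapping.keys (mpderiv i p)"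
          then have "m + Poly_Mapping.single i 1 \<in> Poly_Mapping.keys p"
            by (auto simp: in_keys_iff lookup_mpderiv)
          with deg show "monom_degree m \<le> n"
            using monom_degree_plus_single [of m i] by fastforce
        qed
        moreover have "meval (mpderiv i p) y = 0" if "y \<in> S" for y
        proof -
          let ?l = "\<lambda>t. y + t *\<^sub>R axis i (1::real)"
          have "open (?l -` S)"
            by (intro open_vimage \<open>open S\<close> continuous_intros)
          then have "eventually (\<lambda>t. t \<in> ?l -` S) (nhds 0)"
            using that by (intro eventually_nhds_in_open) auto
          then have "eventually (\<lambda>t. meval p (?l t) = 0) (nhds 0)"
            by eventually_elim (use van in auto)
          then have "deriv (\<lambda>t. meval p (?l t)) 0 = deriv (\<lambda>t. 0) 0"
            by (intro deriv_cong_ev) auto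
          then show ?thesis
            by (simp add: fun_partial_meval [symmetric] fun_partial_def)
        qed
        ultimately show ?thesis using Suc.IH by blast
      qed
      have "\<forall>m\<in>Poly_Mapping.keys p. monom_degree m \<le> n"
      proof
        fix m assume m: "m \<in> Poly_Mapping.keys p"
        have "Poly_Mapping.lookup m i = 0" for i
        proof (rule ccontr)
          let ?e = "Poly_Mapping.single i (1::nat)"
          assume "Poly_Mapping.lookup m i \<noteq> 0"
          then have "m - ?e + ?e = m"
            by (intro poly_mapping_eqI) (auto simp: lookup_add lookup_minus lookup_single when_def)
          with m show False
            using lookup_mpderiv [of i p "m - ?e"] by (simp add: D0 in_keys_iff)
        qed
        then show "monom_degree m \<le> n" by (simp add: monom_degree_def)
      qed
      with van Suc.IH show "p = 0" by blast
    qed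
  qed
  then show ?thesis
    using assms(3) monom_degree_le_total_degree by blast
qed

section \<open>Restriction to a line\<close>

lemma pderiv_line_poly: "pderiv (line_poly p x v) = line_poly (dir_deriv v p) x v"
proof -
  have "poly (pderiv (line_poly p x v)) t = poly (line_poly (dir_deriv v p) x v) t" for t
  proof -
    define y where "y = x + t *\<^sub>R v"
    let ?R = "\<lambda>m i. \<Prod>j\<in>UNIV - {i}. (y $ j) ^ Poly_Mapping.lookup m j"
    have mono: "(\<Prod>j\<in>UNIV. (y $ j) ^ Poly_Mapping.lookup (m - Poly_Mapping.single i 1) j)
        = (y $ i) ^ (Poly_Mapping.lookup m i - 1) * ?R m i" for m i
    proof -
      have "(\<Prod>j\<in>UNIV - {i}. (y $ j) ^ Poly_Mapping.lookup (m - Poly_Mapping.single i 1) j) = ?R m i"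
        by (intro prod.cong) (auto simp: lookup_minus lookup_single)
      then show ?thesis
        by (subst prod.remove [of _ i]) (simp_all add: lookup_minus)
    qed
    have "poly (pderiv (line_poly p x v)) t = (\<Sum>m\<in>Poly_Mapping.keys p. Poly_Mapping.lookup p m *
        (\<Sum>i\<in>UNIV. ?R m i * (real (Poly_Mapping.lookup m i) * (y $ i) ^ (Poly_Mapping.lookup m i - 1) * v $ i)))"
      unfolding line_poly_def higher_pderiv_sum [of 1, simplified] pderiv_smult pderiv_prod
        pderiv_power
      by (simp add: poly_sum poly_prod pderiv_pCons y_def mult_ac)
    also have "\<dots> = (\<Sum>i\<in>UNIV. \<Sum>m\<in>Poly_Mapping.keys p.
        v $ i * (real (Poly_Mapping.lookup m i) * Poly_Mapping.lookup p m * ((y $ i) ^ (Poly_Mapping.lookup m i - 1) * ?R m i)))"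
      by (subst sum.swap) (simp add: sum_distrib_left mult_ac)
    also have "\<dots> = meval (dir_deriv v p) y"
      by (simp only: meval_dir_deriv mpderiv_def meval_sum meval_single mono sum_distrib_left)
    finally show ?thesis by (simp add: poly_line_poly y_def)
  qed
  then show ?thesis by (simp add: poly_eq_poly_eq_iff [symmetric] fun_eq_iff)
qed

lemma higher_pderiv_line_poly:
  "(pderiv ^^ k) (line_poly p x v) = line_poly (foldr dir_deriv (replicate k v) p) x v"
  by (induction k) (simp_all add: pderiv_line_poly)

text \<open>Taylor's formula along a line.\<close>

lemma coeff_line_poly:
  "fact k * coeff (line_poly p x v) k = meval (foldr dir_deriv (replicate k v) p) x"
proof -
  have "fact k * coeff (line_poly p x v) k = coeff ((pderiv ^^ k) (line_poly p x v)) 0"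
    by (simp add: coeff_higher_pderiv pochhammer_fact)
  also have "\<dots> = poly (line_poly (foldr dir_deriv (replicate k v) p) x v) 0"
    by (simp add: higher_pderiv_line_poly poly_0_coeff_0)
  finally show ?thesis by (simp add: poly_line_poly)
qed

lemma has_real_derivative_meval_line:
  "((\<lambda>t. meval p (x + t *\<^sub>R v)) has_real_derivative meval (dir_deriv v p) (x + t *\<^sub>R v)) (at t)"
  using poly_DERIV [of "line_poly p x v" t] by (simp add: poly_line_poly pderiv_line_poly)

text \<open>
  Upper bounds replace the exact degrees because a factor \<open>x\<^sub>i + v\<^sub>i t\<close> is constant when
  \<open>v\<^sub>i = 0\<close>; the coefficient at the bound is then \<open>0\<close>, and multiplicativity persists.
\<close>

lemma coeff_mult_degree_bounds:
  fixes p q :: "'a::comm_semiring_1 poly"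
  assumes "degree p \<le> a" "degree q \<le> b"
  shows "coeff (p * q) (a + b) = coeff p a * coeff q b"
proof (cases "degree p = a \<and> degree q = b")
  case True
  then show ?thesis using coeff_mult_degree_sum by blast
next
  case False
  then have "degree p < a \<or> degree q < b" using assms by auto
  moreover from this have "degree (p * q) < a + b"
    using assms degree_mult_le [of p q] by linarith
  ultimately show ?thesis by (auto simp: coeff_eq_0)
qed

lemma prod_top_coeff:
  fixes g :: "'i \<Rightarrow> 'a::comm_semiring_1 poly"
  assumes "finite A" "\<And>i. i \<in> A \<Longrightarrow> degree (g i) \<le> e i"
  shows "degree (prod g A) \<le> sum e A \<and> coeff (prod g A) (sum e A) = (\<Prod>i\<in>A. coeff (g i) (e i))"
  using assms
proof (induction A rule: finite_induct)
  case (insert i A)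
  then have IH: "degree (prod g A) \<le> sum e A"
      "coeff (prod g A) (sum e A) = (\<Prod>i\<in>A. coeff (g i) (e i))"
    and i: "degree (g i) \<le> e i" by auto
  have "degree (g i * prod g A) \<le> e i + sum e A"
    using degree_mult_le [of "g i" "prod g A"] IH(1) i by linarith
  then show ?case
    using insert.hyps coeff_mult_degree_bounds [OF i IH(1)] IH(2) by simp
qed simp

definition top_part :: "'n::finite mpoly \<Rightarrow> 'n mpoly" where
  "top_part p = (\<Sum>m\<in>{m \<in> Poly_Mapping.keys p. monom_degree m = total_degree p}.
     Poly_Mapping.single m (Poly_Mapping.lookup p m))"

lemma line_poly_top:
  "degree (line_poly p x v) \<le> total_degree p"
  "coeff (line_poly p x v) (total_degree p) = meval (top_part p) v"
proof -
  define M where "M m = (\<Prod>i\<in>UNIV. [:x $ i, v $ i:] ^ Poly_Mapping.lookup m i)" for m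
  have power: "degree ([:a, b:] ^ n) \<le> n" "coeff ([:a, b:] ^ n) n = b ^ n" for a b :: real and n
    using prod_top_coeff [of "{..<n}" "\<lambda>_. [:a, b:]" "\<lambda>_. 1"] by auto
  have M: "degree (M m) \<le> monom_degree m"
      "coeff (M m) (monom_degree m) = (\<Prod>i\<in>UNIV. (v $ i) ^ Poly_Mapping.lookup m i)" for m
    using prod_top_coeff [of UNIV "\<lambda>i. [:x $ i, v $ i:] ^ Poly_Mapping.lookup m i" "Poly_Mapping.lookup m"] power
    by (auto simp: M_def monom_degree_def)
  have line: "line_poly p x v = (\<Sum>m\<in>Poly_Mapping.keys p. smult (Poly_Mapping.lookup p m) (M m))"
    by (simp add: line_poly_def M_def)
  show "degree (line_poly p x v) \<le> total_degree p"
    unfolding line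
  proof (intro degree_sum_le)
    fix m assume "m \<in> Poly_Mapping.keys p"
    then show "degree (smult (Poly_Mapping.lookup p m) (M m)) \<le> total_degree p"
      using M(1) [of m] monom_degree_le_total_degree [of m p] degree_smult_le [of "Poly_Mapping.lookup p m" "M m"]
      by linarith
  qed simp
  have "coeff (M m) (total_degree p)
      = (if monom_degree m = total_degree p then \<Prod>i\<in>UNIV. (v $ i) ^ Poly_Mapping.lookup m i else 0)"
    if "m \<in> Poly_Mapping.keys p" for m
    using M [of m] monom_degree_le_total_degree [OF that] by (auto intro!: coeff_eq_0)
  then have "coeff (line_poly p x v) (total_degree p)
      = (\<Sum>m\<in>Poly_Mapping.keys p. if monom_degree m = total_degree p
           then Poly_Mapping.lookup p m * (\<Prod>i\<in>UNIV. (v $ i) ^ Poly_Mapping.lookup m i) else 0)"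
    unfolding line coeff_sum by (intro sum.cong) auto
  also have "\<dots> = meval (top_part p) v"
    unfolding top_part_def meval_sum meval_single
    by (subst sum.inter_filter) simp_all
  finally show "coeff (line_poly p x v) (total_degree p) = meval (top_part p) v" .
qed

lemma top_part_nonzero:
  assumes "p \<noteq> 0"
  shows "top_part p \<noteq> 0"
proof -
  obtain m where m: "m \<in> Poly_Mapping.keys p" "monom_degree m = total_degree p"
    using monom_of_total_degree [OF assms] .
  then have "Poly_Mapping.lookup (top_part p) m = Poly_Mapping.lookup p m"
    by (simp add: top_part_def lookup_sum lookup_single when_def)
  with m show ?thesis by (auto simp: in_keys_iff)
qed

text \<open>
  If \<open>p\<close> had the larger degree, \<open>q - p\<close> would have leading coefficient opposite to that of \<open>p\<close>,
  although both are nonnegative on the half-line.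
\<close>

lemma degree_mono_of_poly_le:
  fixes p q :: "real poly"
  assumes "\<And>t. t \<ge> 0 \<Longrightarrow> 0 \<le> poly p t" and "\<And>t. t \<ge> 0 \<Longrightarrow> poly p t \<le> poly q t"
  shows "degree p \<le> degree q"
proof (rule ccontr)
  assume less: "\<not> degree p \<le> degree q"
  \<comment> \<open>A polynomial with negative leading coefficient is eventually negative.\<close>
  have lead: "lead_coeff r \<ge> 0" if "\<And>t. t \<ge> 0 \<Longrightarrow> 0 \<le> poly r t" for r :: "real poly"
  proof (rule ccontr)
    assume "\<not> lead_coeff r \<ge> 0"
    then obtain n where "\<forall>t\<ge>n. lead_coeff (- r) \<le> poly (- r) t"
      using poly_pinfty_gt_lc [of "- r"] by auto
    then have "poly r (max 0 n) < 0"
      using \<open>\<not> lead_coeff r \<ge> 0\<close> by (auto dest!: spec [of _ "max 0 n"])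
    with that [of "max 0 n"] show False by simp
  qed
  have "degree (q - p) = degree p"
    using less degree_add_eq_right [of q "- p"] by simp
  then have "lead_coeff (q - p) = - lead_coeff p"
    using less by (simp add: coeff_eq_0)
  moreover have "lead_coeff (q - p) \<ge> 0"
    by (rule lead) (use assms(2) in simp)
  moreover have "lead_coeff p \<ge> 0"
    by (rule lead) (rule assms(1))
  ultimately have "p = 0" by auto
  with less show False by simp
qed

section \<open>Monotonicity along the cone\<close>

lemma convex_cone_interior_add:
  fixes K :: "'a::real_normed_vector set"
  assumes "convex_cone K" "y \<in> interior K" "u \<in> K"
  shows "y + u \<in> interior K"
proof -
  have "(+) u ` interior K \<subseteq> K"
    using assms interior_subset by (auto intro!: convex_cone_add)
  moreover have "open ((+) u ` interior K)" by (rule open_translation) simp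
  ultimately have "(+) u ` interior K \<subseteq> interior K" by (rule interior_maximal)
  then have "u + y \<in> interior K" using assms(2) by auto
  then show ?thesis by (simp add: add.commute)
qed

lemma convex_cone_interior_scaleR:
  fixes K :: "'a::real_normed_vector set"
  assumes "convex_cone K" "y \<in> interior K" "c > 0"
  shows "c *\<^sub>R y \<in> interior K"
proof -
  have "(*\<^sub>R) c ` interior K \<subseteq> K"
    using assms interior_subset by (auto intro!: convex_cone_scaleR)
  moreover have "open ((*\<^sub>R) c ` interior K)" using assms by (intro open_scaling) auto
  ultimately have "(*\<^sub>R) c ` interior K \<subseteq> interior K" by (rule interior_maximal)
  then show ?thesis using assms(2) by auto
qed

lemma meval_mono_cone:
  assumes cone: "convex_cone K"
    and deriv: "\<And>y. y \<in> interior K \<Longrightarrow> 0 \<le> meval (dir_deriv u f) y"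
    and y: "y \<in> interior K" and u: "u \<in> K"
  shows "meval f y \<le> meval f (y + u)"
proof -
  have "meval f (y + 0 *\<^sub>R u) \<le> meval f (y + 1 *\<^sub>R u)"
  proof (rule DERIV_nonneg_imp_nondecreasing [where f = "\<lambda>t. meval f (y + t *\<^sub>R u)"])
    fix t :: real assume "0 \<le> t"
    then have "y + t *\<^sub>R u \<in> interior K"
      using cone y u by (intro convex_cone_interior_add convex_cone_scaleR)
    then show "\<exists>D. ((\<lambda>t. meval f (y + t *\<^sub>R u)) has_real_derivative D) (at t) \<and> 0 \<le> D"
      using has_real_derivative_meval_line deriv by blast
  qed simp
  then show ?thesis by simp
qed

text \<open>
  Comparing the growth along \<open>v\<close> with that along all directions \<open>w\<close> below \<open>v\<close> in the order of the
  cone shows that the top homogeneous part cannot vanish at an interior point.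
\<close>

lemma degree_line_poly_interior:
  assumes cone: "convex_cone K" and "f \<noteq> 0"
    and pos: "\<And>y. y \<in> interior K \<Longrightarrow> 0 < meval f y"
    and deriv: "\<And>u y. u \<in> K \<Longrightarrow> y \<in> interior K \<Longrightarrow> 0 \<le> meval (dir_deriv u f) y"
    and x: "x \<in> interior K" and v: "v \<in> interior K"
  shows "degree (line_poly f x v) = total_degree f"
proof (rule ccontr)
  assume "degree (line_poly f x v) \<noteq> total_degree f"
  then have small: "degree (line_poly f x v) < total_degree f"
    using line_poly_top(1) [of f x v] by linarith
  define S where "S = interior K \<inter> (\<lambda>w. v - w) -` interior K"
  have "open S"
    unfolding S_def by (intro open_Int open_vimage open_interior continuous_intros)
  moreover have "S \<noteq> {}"
  proof -
    have "v - (1/2) *\<^sub>R v = (1/2) *\<^sub>R v"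
      by (simp add: vec_eq_iff)
    moreover have "(1/2) *\<^sub>R v \<in> interior K"
      by (rule convex_cone_interior_scaleR [OF cone v]) simp
    ultimately have "(1/2) *\<^sub>R v \<in> S"
      unfolding S_def by (metis IntI vimageI)
    then show ?thesis by auto
  qed
  moreover have "meval (top_part f) w = 0" if "w \<in> S" for w
  proof -
    have w: "w \<in> interior K" "w \<in> K" "v - w \<in> K"
      using that interior_subset by (auto simp: S_def)
    have in_int: "x + t *\<^sub>R w \<in> interior K" if "t \<ge> 0" for t
      using that w x cone by (intro convex_cone_interior_add convex_cone_scaleR)
    have "degree (line_poly f x w) \<le> degree (line_poly f x v)"
    proof (rule degree_mono_of_poly_le; unfold poly_line_poly)
      fix t :: real assume t: "t \<ge> 0"
      show "0 \<le> meval f (x + t *\<^sub>R w)" using pos [OF in_int [OF t]] by simp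
      have "t *\<^sub>R (v - w) \<in> K" using cone t w by (intro convex_cone_scaleR)
      then have "meval f (x + t *\<^sub>R w) \<le> meval f (x + t *\<^sub>R w + t *\<^sub>R (v - w))"
        using deriv in_int [OF t] by (intro meval_mono_cone [OF cone]) auto
      then show "meval f (x + t *\<^sub>R w) \<le> meval f (x + t *\<^sub>R v)"
        by (simp add: algebra_simps)
    qed
    with small have "coeff (line_poly f x w) (total_degree f) = 0"
      by (intro coeff_eq_0) linarith
    then show ?thesis by (simp add: line_poly_top(2))
  qed
  ultimately have "top_part f = 0" by (rule mpoly_eq_0_if_vanishes_on_open)
  with top_part_nonzero [OF \<open>f \<noteq> 0\<close>] show False by simp
qed

theorem proposition3p14:
  fixes K :: "(real ^ 'n::finite) set" and f :: "'n mpoly" and d :: nat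
    and x v :: "real ^ 'n"
  assumes "proper_convex_cone K"
    and "f \<noteq> 0"
    and "completely_log_concave K f"
    and "total_degree f = d"
    and "x \<in> interior K" and "v \<in> interior K"
  shows "\<forall>k\<le>d. coeff (line_poly f x v) k > 0"
proof (intro allI impI)
  fix k assume k: "k \<le> d"
  have cone: "convex_cone K" using assms(1) by (simp add: proper_convex_cone_def)
  have v: "v \<in> K" using assms(6) interior_subset by auto
  have clc: "foldr dir_deriv as f = 0 \<or> 0 < meval (foldr dir_deriv as f) y"
    if "length as \<le> d" "set as \<subseteq> K" "y \<in> interior K" for as y
    using assms(3,4) that unfolding completely_log_concave_def log_concave_at_def by blast
  have pos: "0 < meval f y" if "y \<in> interior K" for y
    using clc [of "[]" y] that \<open>f \<noteq> 0\<close> by simp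
  have deg: "degree (line_poly f x v) = d"
  proof (cases "d = 0")
    case True
    then show ?thesis using line_poly_top(1) [of f x v] assms(4) by simp
  next
    case False
    have "0 \<le> meval (dir_deriv u f) y" if "u \<in> K" "y \<in> interior K" for u y
      using clc [of "[u]" y] that False by auto
    then show ?thesis
      using degree_line_poly_interior [OF cone assms(2) pos _ assms(5,6)] assms(4) by simp
  qed
  let ?g = "foldr dir_deriv (replicate k v) f"
  have "?g \<noteq> 0"
  proof
    assume "?g = 0"
    then have "(pderiv ^^ k) (line_poly f x v) = 0"
      by (simp only: higher_pderiv_line_poly) (simp add: line_poly_def)
    \<comment> \<open>The coefficient of \<open>t\<^bsup>d - k\<^esup>\<close> in the \<open>k\<close>-th derivative is a positive multiple of the leading coefficient.\<close>
    then have "coeff ((pderiv ^^ k) (line_poly f x v)) (d - k) = 0" by simp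
    then have "lead_coeff (line_poly f x v) = 0"
      using k deg by (simp add: coeff_higher_pderiv pochhammer_eq_0_iff)
    then have "poly (line_poly f x v) 0 = 0" by simp
    then show False
      using pos [OF assms(5)] by (simp add: poly_line_poly)
  qed
  moreover have "set (replicate k v) \<subseteq> K" using v by auto
  ultimately have "0 < meval ?g x"
    using clc [of "replicate k v" x] k assms(5) by auto
  then have "0 < fact k * coeff (line_poly f x v) k"
    by (simp only: coeff_line_poly)
  then show "coeff (line_poly f x v) k > 0"
    by (simp add: zero_less_mult_iff)
qed

end
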